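(* Let $P=(p^{(1)},\dots,p^{(n)})$ and $Q=(q^{(1)},\dots,q^{(n)})$ be matrices in $\mathbb{R}^{d\times n}$ with columns $p^{(i)},q^{(i)}\in\mathbb{R}^d$, and let $p\in[2,\infty]$. Let $A^*$ be a minimizer of $\mathrm{E}_p(A)$ over $A\in\mathbb{R}^{d\times d}$, and let $\hat R=\Pi(A^* )$. Let $\mathrm{E}^*=\min_{R\in O(d)}\mathrm{E}(R)$. Then $$\mathrm{E}^*\le \mathrm{E}(\hat R)\le 2\,\mathrm{E}_p(A^* )\le 2\,\mathrm{E}^*.$$ Moreover, if $p=2$ then $$\mathrm{E}^*\le \mathrm{E}(\hat R)\le \sqrt2\,\mathrm{E}_2(A^* )\le \sqrt2\,\mathrm{E}^*.$$
   Context: $\|\cdot\|$ is the Euclidean norm and $O(d)$ is the set of $d\times d$ real orthogonal matrices. For $R\in O(d)$, $\mathrm{E}(R)=\sum_{i=1}^n\|Rp^{(i)}-q^{(i)}\|$. For $A\in\mathbb{R}^{d\times d}$ and $1\le p<\infty$, $$\mathrm{E}_p(A)=\sum_{i=1}^n\left(\frac{\|Ap^{(i)}-q^{(i)}\|^p+\|A^Tq^{(i)}-p^{(i)}\|^p}{2}\right)^{1/p},$$ and $\mathrm{E}_\infty(A)=\sum_{i=1}^n\max\{\|Ap^{(i)}-q^{(i)}\|,\|A^Tq^{(i)}-p^{(i)}\|\}$. For $A\in\mathbb{R}^{d\times d}$, $\Pi(A)=UV^T\in O(d)$, where $A=U\Sigma V^T$ is a singular value decomposition of $A$ ($U,V\in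 O(d)$, $\Sigma$ diagonal with nonnegative entries); any choice of SVD is allowed. *)

theory Defs
  imports "HOL-Analysis.Analysis"
begin

definition E :: "real ^ 'n ^ 'd \<Rightarrow> real ^ 'n ^ 'd \<Rightarrow> real ^ 'd ^ 'd \<Rightarrow> real" where
  "E P Q R = (\<Sum>i\<in>UNIV. norm (R *v column i P - column i Q))"

(* The exponent is an extended real so that one family covers both 1 \<le> p < \<infinity>
   and p = \<infinity>; it is only meaningful for p \<ge> 1. *)
definition E_p :: "ereal \<Rightarrow> real ^ 'n ^ 'd \<Rightarrow> real ^ 'n ^ 'd \<Rightarrow> real ^ 'd ^ 'd \<Rightarrow> real" where
  "E_p p P Q A =
    (if p = \<infinity>
     then (\<Sum>i\<in>UNIV. max (norm (A *v column i P - column i Q))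
                           (norm (transpose A *v column i Q - column i P)))
     else (\<Sum>i\<in>UNIV. ((norm (A *v column i P - column i Q) powr real_of_ereal p
                        + norm (transpose A *v column i Q - column i P) powr real_of_ereal p) / 2)
                       powr (1 / real_of_ereal p)))"

definition is_svd :: "real ^ 'd ^ 'd \<Rightarrow> real ^ 'd ^ 'd \<Rightarrow> real ^ 'd ^ 'd \<Rightarrow> real ^ 'd ^ 'd \<Rightarrow> bool" where
  "is_svd A U S V \<longleftrightarrow>
     orthogonal_matrix U \<and> orthogonal_matrix V \<and>
     (\<forall>i j. i \<noteq> j \<longrightarrow> S $ i $ j = 0) \<and> (\<forall>i. 0 \<le> S $ i $ i) \<and>
     A = U ** S ** transpose V"

(* A relation rather than a function: for singular A the matrix U V^T depends on
   the chosen singular value decomposition, and every choice is allowed. *)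
definition is_orth_proj :: "real ^ 'd ^ 'd \<Rightarrow> real ^ 'd ^ 'd \<Rightarrow> bool" where
  "is_orth_proj A R \<longleftrightarrow> (\<exists>U S V. is_svd A U S V \<and> R = U ** transpose V)"

(* The infimum is attained, see E_min_attained. *)
definition E_min :: "real ^ 'n ^ 'd \<Rightarrow> real ^ 'n ^ 'd \<Rightarrow> real" where
  "E_min P Q = (INF R\<in>{R. orthogonal_matrix R}. E P Q R)"

lemma compact_orthogonal_matrices: "compact {R :: real ^ 'd ^ 'd. orthogonal_matrix R}"
proof -
  have "closed {R :: real ^ 'd ^ 'd. transpose R ** R = mat 1}"
    unfolding matrix_matrix_mult_def transpose_def
    by (intro closed_Collect_eq continuous_intros)
  moreover have "bounded {R :: real ^ 'd ^ 'd. orthogonal_matrix R}"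
    unfolding bounded_iff
  proof (intro exI ballI)
    fix R :: "real ^ 'd ^ 'd"
    assume "R \<in> {R. orthogonal_matrix R}"
    then have *: "norm (R $ i) = 1" for i
      by (simp add: orthogonal_matrix_orthonormal_rows row_def)
    have "norm R \<le> (\<Sum>i\<in>UNIV. norm (R $ i))"
      unfolding norm_vec_def by (rule L2_set_le_sum) simp
    then show "norm R \<le> real CARD('d)"
      by (simp add: *)
  qed
  ultimately show ?thesis
    by (simp add: compact_eq_bounded_closed orthogonal_matrix)
qed

lemma E_min_attained:
  "\<exists>R. orthogonal_matrix R \<and> E P Q R = E_min P Q \<and> (\<forall>R'. orthogonal_matrix R' \<longrightarrow> E P Q R \<le> E P Q R')"
proof -
  have cont: "continuous_on {R. orthogonal_matrix R} (E P Q)"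
    unfolding E_def matrix_vector_mult_def
    by (intro continuous_intros)
  have "{R :: real ^ 'd ^ 'd. orthogonal_matrix R} \<noteq> {}"
    using orthogonal_matrix_id by blast
  from continuous_attains_inf[OF compact_orthogonal_matrices this cont]
  obtain R where R: "orthogonal_matrix R" "\<forall>R'. orthogonal_matrix R' \<longrightarrow> E P Q R \<le> E P Q R'"
    by auto
  then have "E_min P Q = E P Q R"
    unfolding E_min_def by (intro cInf_eq_minimum) auto
  with R show ?thesis by auto
qed

end

theory Submission
  imports Defs
begin

text \<open>
  In the coordinates given by a singular value decomposition of \<open>A\<close>, every residual is a sum over
  the singular values \<open>s\<close> of \<open>(s x - y)\<^sup>2\<close>, \<open>(s y - x)\<^sup>2\<close> or \<open>(x - y)\<^sup>2\<close>. The factor 2 follows from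
  \<open>(x - y)\<^sup>2 \<le> 2 ((s x - y)\<^sup>2 + (s y - x)\<^sup>2)\<close> for \<open>s \<ge> 0\<close> and the monotonicity of power means, for
  every matrix \<open>A\<close>.

  The factor \<open>sqrt 2\<close> needs minimality of \<open>A\<close>. Replacing each square root by its tangent bound
  turns the claim into one about a weighted least-squares problem, which decouples over the singular
  values. For \<open>s \<noteq> 1\<close>, stationarity in \<open>s\<close> gives \<open>s (\<Sum> w (x\<^sup>2 + y\<^sup>2)) = 2 (\<Sum> w x y)\<close>, hence \<open>s \<le> 1\<close>
  unless all \<open>w (x\<^sup>2 + y\<^sup>2)\<close> vanish, and the contribution of \<open>s\<close> is
  \<open>(s\<^sup>2 - s) (\<Sum> w (x\<^sup>2 + y\<^sup>2)) \<le> 0\<close>. Points with zero residual, where the square root is not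
  differentiable, have \<open>x = y = 0\<close> at every singular value other than 1, so they do not obstruct
  stationarity.
\<close>

declare transpose_matrix_vector [simp del]

section \<open>Residuals in singular value coordinates\<close>

definition diag_mat :: "('d \<Rightarrow> real) \<Rightarrow> real ^ 'd ^ 'd" where
  "diag_mat s = (\<chi> i j. if i = j then s i else 0)"

lemma diag_mat_mult_vec: "(diag_mat s *v x) $ k = s k * x $ k"
proof -
  have "(diag_mat s *v x) $ k = (\<Sum>j\<in>UNIV. (if k = j then s k else 0) * x $ j)"
    by (simp add: diag_mat_def matrix_vector_mult_def)
  also have "\<dots> = (\<Sum>j\<in>UNIV. if k = j then s k * x $ j else 0)"
    by (intro sum.cong) auto
  finally show ?thesis by simp
qed

lemma transpose_diag_mat: "transpose (diag_mat s) = diag_mat s"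
  by (auto simp: diag_mat_def transpose_def vec_eq_iff)

lemma diag_mat_one: "diag_mat (\<lambda>_. 1) = mat 1"
  by (simp add: diag_mat_def mat_def)

lemma norm_power2_eq_sum: "(norm (x :: real ^ 'd))\<^sup>2 = (\<Sum>k\<in>UNIV. (x $ k)\<^sup>2)"
  unfolding power2_norm_eq_inner inner_vec_def by (simp add: power2_eq_square)

lemma norm_orthogonal_matrix_mult:
  fixes U :: "real ^ 'd ^ 'd"
  assumes "orthogonal_matrix U"
  shows "norm (U *v x) = norm x"
  using assms orthogonal_transformation_matrix[of "(*v) U"] orthogonal_transformation_norm[of "(*v) U"]
  by simp

lemma norm_diff_diag_mat:
  fixes U V :: "real ^ 'd ^ 'd"
  assumes U: "orthogonal_matrix U"
  shows "(norm ((U ** diag_mat s ** transpose V) *v p - q))\<^sup>2 =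
    (\<Sum>k\<in>UNIV. (s k * (transpose V *v p) $ k - (transpose U *v q) $ k)\<^sup>2)"
proof -
  have "U *v (transpose U *v q) = q"
    using U by (simp add: matrix_vector_mul_assoc orthogonal_matrix_def)
  then have "(U ** diag_mat s ** transpose V) *v p - q =
      U *v (diag_mat s *v (transpose V *v p) - transpose U *v q)"
    by (simp add: matrix_vector_mult_diff_distrib flip: matrix_vector_mul_assoc)
  then show ?thesis
    by (simp add: norm_orthogonal_matrix_mult[OF U] norm_power2_eq_sum diag_mat_mult_vec)
qed

text \<open>The isometry \<open>R\<close> maps one residual to the negative of the other.\<close>

lemma norm_diff_transpose_orthogonal:
  fixes R :: "real ^ 'd ^ 'd"
  assumes "orthogonal_matrix R"
  shows "norm (transpose R *v q - p) = norm (R *v p - q)"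
proof -
  have "R *v (transpose R *v q - p) = q - R *v p"
    using assms
    by (simp add: matrix_vector_mult_diff_distrib matrix_vector_mul_assoc orthogonal_matrix_def)
  then show ?thesis
    using norm_orthogonal_matrix_mult[OF assms, of "transpose R *v q - p"]
    by (simp add: norm_minus_commute)
qed

text \<open>Twice the squared summand of \<open>E_p 2\<close>, for a point pair with coordinates
  \<open>x\<close> and \<open>y\<close> in the singular bases. Entries of \<open>s\<close> may be
  negative, so perturbations in both directions are covered.\<close>

definition residual :: "('d::finite \<Rightarrow> real) \<Rightarrow> ('d \<Rightarrow> real) \<Rightarrow> ('d \<Rightarrow> real) \<Rightarrow> real" where
  "residual s x y = (\<Sum>k\<in>UNIV. (s k * x k - y k)\<^sup>2 + (s k * y k - x k)\<^sup>2)"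

lemma residual_nonneg: "0 \<le> residual s x y"
  unfolding residual_def by (intro sum_nonneg) auto

lemma residual_diag_mat:
  fixes U V :: "real ^ 'd ^ 'd"
  assumes "orthogonal_matrix U" "orthogonal_matrix V" and A: "A = U ** diag_mat s ** transpose V"
  shows "(norm (A *v p - q))\<^sup>2 + (norm (transpose A *v q - p))\<^sup>2 =
    residual s (\<lambda>k. (transpose V *v p) $ k) (\<lambda>k. (transpose U *v q) $ k)"
proof -
  have "transpose A = V ** diag_mat s ** transpose U"
    by (simp add: A matrix_transpose_mul transpose_diag_mat matrix_mul_assoc)
  then show ?thesis
    using assms by (simp add: norm_diff_diag_mat residual_def sum.distrib)
qed

text \<open>\<open>R\<close> is \<open>A\<close> with every singular value replaced by 1, so its
  residuals are read off in the same coordinates.\<close>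

lemma is_orth_projE:
  fixes A :: "real ^ 'd ^ 'd"
  assumes "is_orth_proj A R"
  obtains U V s where "orthogonal_matrix U" "orthogonal_matrix V" "\<And>k. 0 \<le> s k"
    "A = U ** diag_mat s ** transpose V" "orthogonal_matrix R"
    "\<And>p q. (norm (R *v p - q))\<^sup>2 =
      (\<Sum>k\<in>UNIV. ((transpose V *v p) $ k - (transpose U *v q) $ k)\<^sup>2)"
proof -
  from assms obtain U S V where 1: "is_svd A U S V" "R = U ** transpose V"
    unfolding is_orth_proj_def by blast
  then have S: "S = diag_mat (\<lambda>k. S $ k $ k)"
    by (auto simp: is_svd_def diag_mat_def vec_eq_iff)
  show thesis
  proof (rule that[of U V "\<lambda>k. S $ k $ k"])
    show "A = U ** diag_mat (\<lambda>k. S $ k $ k) ** transpose V"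
      using 1 S by (simp add: is_svd_def)
    show "orthogonal_matrix R"
      using 1 by (simp add: is_svd_def orthogonal_matrix_mul orthogonal_matrix_transpose)
    show "(norm (R *v p - q))\<^sup>2 =
      (\<Sum>k\<in>UNIV. ((transpose V *v p) $ k - (transpose U *v q) $ k)\<^sup>2)" for p q
      using 1 norm_diff_diag_mat[of U "\<lambda>_. 1" V p q]
      by (simp add: diag_mat_one is_svd_def)
  qed (use 1 in \<open>auto simp: is_svd_def\<close>)
qed

section \<open>Pointwise bound for the factor 2\<close>

lemma diff_power2_le_residual:
  fixes s x y :: real
  assumes "0 \<le> s"
  shows "(x - y)\<^sup>2 \<le> 2 * ((s * x - y)\<^sup>2 + (s * y - x)\<^sup>2)"
proof -
  \<comment> \<open>The two terms have sum \<open>(s - 1) * (x + y)\<close> and difference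
    \<open>(s + 1) * (x - y)\<close>; the parallelogram law then gives this form.\<close>
  have "2 * (2 * ((s * x - y)\<^sup>2 + (s * y - x)\<^sup>2) - (x - y)\<^sup>2) =
      2 * (s - 1)\<^sup>2 * (x + y)\<^sup>2 + (2 * s\<^sup>2 + 4 * s) * (x - y)\<^sup>2"
    by (simp add: power2_eq_square algebra_simps)
  moreover have "0 \<le> 2 * (s - 1)\<^sup>2 * (x + y)\<^sup>2 + (2 * s\<^sup>2 + 4 * s) * (x - y)\<^sup>2"
    using assms by simp
  ultimately have "0 \<le> 2 * (2 * ((s * x - y)\<^sup>2 + (s * y - x)\<^sup>2) - (x - y)\<^sup>2)"
    by (simp only:)
  then show ?thesis by simp
qed

lemma orth_proj_residual_le:
  assumes "is_orth_proj A R"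
  shows "(norm (R *v p - q))\<^sup>2 \<le> 2 * ((norm (A *v p - q))\<^sup>2 + (norm (transpose A *v q - p))\<^sup>2)"
  using assms
proof (rule is_orth_projE)
  fix U V s
  assume UV: "orthogonal_matrix U" "orthogonal_matrix V" "A = U ** diag_mat s ** transpose V"
    and s: "\<And>k. 0 \<le> s k"
    and R: "\<And>p q. (norm (R *v p - q))\<^sup>2 =
      (\<Sum>k\<in>UNIV. ((transpose V *v p) $ k - (transpose U *v q) $ k)\<^sup>2)"
  show ?thesis
    unfolding residual_diag_mat[OF UV] R residual_def sum_distrib_left
    by (intro sum_mono diff_power2_le_residual s)
qed

section \<open>Minimizing over the singular values\<close>

lemma sqrt_le_tangent:
  assumes "0 < a" "0 \<le> b"
  shows "sqrt b \<le> sqrt a + (b - a) / (2 * sqrt a)"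
proof -
  define c where "c = sqrt a"
  then have c: "0 < c" "a = c * c" using assms by auto
  have "0 \<le> (sqrt b - c)\<^sup>2" by simp
  then have "2 * c * sqrt b \<le> c * c + b"
    using assms by (simp add: power2_diff power2_eq_square[of c] mult_ac)
  then have "sqrt b \<le> (c * c + b) / (2 * c)"
    using c(1) by (simp add: pos_le_divide_eq mult_ac)
  also have "\<dots> = c + (b - c * c) / (2 * c)"
    using c(1) by (simp add: field_simps)
  finally show ?thesis unfolding c_def[symmetric] c(2)[symmetric] .
qed

lemma linear_coeff_eq_0_if_quadratic_nonneg:
  fixes b c :: real
  assumes "\<And>t. 0 \<le> b * t + c * t\<^sup>2" and "0 \<le> c"
  shows "b = 0"
proof -
  \<comment> \<open>Dividing by \<open>c + 1\<close> instead of \<open>c\<close> also covers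
    \<open>c = 0\<close>.\<close>
  have "0 \<le> b * (- b / (c + 1)) + c * (- b / (c + 1))\<^sup>2" by (rule assms(1))
  also have "\<dots> = - (b / (c + 1))\<^sup>2"
    using assms(2) by (simp add: power_divide divide_simps) (simp add: power2_eq_square algebra_simps)
  finally show ?thesis using assms(2) by simp
qed

lemma residual_eq_0D:
  assumes "residual s x y = 0" "0 \<le> s k"
  shows "x k = y k" and "s k \<noteq> 1 \<Longrightarrow> x k = 0 \<and> y k = 0"
proof -
  have "(s k * x k - y k)\<^sup>2 + (s k * y k - x k)\<^sup>2 = 0"
    using assms(1) unfolding residual_def by (subst (asm) sum_nonneg_eq_0_iff) auto
  then have *: "s k * x k = y k" "s k * y k = x k"
    by (auto simp: sum_power2_eq_zero_iff)
  then have "(s k + 1) * (x k - y k) = 0" by (simp add: algebra_simps)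
  then show 1: "x k = y k" using assms(2) by simp
  from * 1 show "x k = 0 \<and> y k = 0" if "s k \<noteq> 1" using that by simp
qed

text \<open>The expansion in one singular value is exact, so the tangent bound yields a quadratic in
  \<open>t\<close> without remainder.\<close>

lemma residual_fun_upd:
  "residual (s(k := s k + t)) x y =
    residual s x y + (2 * s k * ((x k)\<^sup>2 + (y k)\<^sup>2) - 4 * (x k * y k)) * t + ((x k)\<^sup>2 + (y k)\<^sup>2) * t\<^sup>2"
proof -
  have "residual (s(k := s k + t)) x y =
      ((s k + t) * x k - y k)\<^sup>2 + ((s k + t) * y k - x k)\<^sup>2 +
      (\<Sum>j\<in>UNIV - {k}. (s j * x j - y j)\<^sup>2 + (s j * y j - x j)\<^sup>2)"
    unfolding residual_def by (subst sum.remove[of _ k]) auto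
  moreover have "residual s x y =
      (s k * x k - y k)\<^sup>2 + (s k * y k - x k)\<^sup>2 +
      (\<Sum>j\<in>UNIV - {k}. (s j * x j - y j)\<^sup>2 + (s j * y j - x j)\<^sup>2)"
    unfolding residual_def by (subst sum.remove[of _ k]) auto
  ultimately show ?thesis by (simp add: power2_eq_square algebra_simps)
qed

lemma sum_sqrt_residual_minimizer:
  fixes s :: "'d::finite \<Rightarrow> real" and x y :: "'n::finite \<Rightarrow> 'd \<Rightarrow> real"
  assumes s: "\<And>k. 0 \<le> s k"
    and min: "\<And>s'. (\<Sum>i\<in>UNIV. sqrt (residual s (x i) (y i))) \<le> (\<Sum>i\<in>UNIV. sqrt (residual s' (x i) (y i)))"
  shows "(\<Sum>i\<in>UNIV. sqrt (\<Sum>k\<in>UNIV. (x i k - y i k)\<^sup>2)) \<le> (\<Sum>i\<in>UNIV. sqrt (residual s (x i) (y i)))"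
proof -
  define N where "N i = residual s (x i) (y i)" for i
  define D where "D i = (\<Sum>k\<in>UNIV. (x i k - y i k)\<^sup>2)" for i
  \<comment> \<open>Since \<open>1 / 0 = 0\<close>, points with zero residual get weight zero.\<close>
  define w where "w i = 1 / (2 * sqrt (N i))" for i
  have N0: "0 \<le> N i" and w0: "0 \<le> w i" for i
    by (simp_all add: N_def w_def residual_nonneg)
  \<comment> \<open>If \<open>N i = 0\<close>, the weight is zero and the bound reads
    \<open>sqrt b \<le> 0\<close>; hence the second premise.\<close>
  have tangent: "sqrt b \<le> sqrt (N i) + w i * (b - N i)" if "0 \<le> b" "N i = 0 \<Longrightarrow> b = 0" for b i
  proof (cases "N i = 0")
    case False
    then show ?thesis using sqrt_le_tangent[of "N i" b] N0[of i] that by (simp add: w_def)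
  qed (use that in simp)
  have contrib: "(\<Sum>i\<in>UNIV. w i * ((x i k - y i k)\<^sup>2 -
      ((s k * x i k - y i k)\<^sup>2 + (s k * y i k - x i k)\<^sup>2))) \<le> 0" (is "?L \<le> 0") for k
  proof (cases "s k = 1")
    case True
    \<comment> \<open>Each bracket equals \<open>- (x i k - y i k)\<^sup>2\<close> here. This case
      is separate because a point with zero residual may have nonzero coordinates at singular value
      1.\<close>
    then show ?thesis
      by (intro sum_nonpos mult_nonneg_nonpos w0) (simp add: power2_commute[of "y _ k"])
  next
    case False
    define C where "C = (\<Sum>i\<in>UNIV. w i * ((x i k)\<^sup>2 + (y i k)\<^sup>2))"
    define G where "G = (\<Sum>i\<in>UNIV. w i * (x i k * y i k))"
    have C0: "0 \<le> C" unfolding C_def by (intro sum_nonneg mult_nonneg_nonneg w0) auto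
    \<comment> \<open>The tangent majorant touches the objective at \<open>t = 0\<close>, so
      minimality passes to it, and its linear coefficient must vanish.\<close>
    have "0 \<le> (2 * s k * C - 4 * G) * t + C * t\<^sup>2" for t
    proof -
      let ?s = "s(k := s k + t)"
      have "(\<Sum>i\<in>UNIV. sqrt (N i)) \<le> (\<Sum>i\<in>UNIV. sqrt (residual ?s (x i) (y i)))"
        unfolding N_def by (rule min)
      also have "\<dots> \<le> (\<Sum>i\<in>UNIV. sqrt (N i) + w i * (residual ?s (x i) (y i) - N i))"
      proof (intro sum_mono tangent residual_nonneg)
        fix i assume "N i = 0"
        then show "residual ?s (x i) (y i) = 0"
          using residual_eq_0D(2)[of s "x i" "y i" k] s False
          unfolding residual_fun_upd by (simp add: N_def)
      qed
      also have "\<dots> = (\<Sum>i\<in>UNIV. sqrt (N i)) + ((2 * s k * C - 4 * G) * t + C * t\<^sup>2)"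
        unfolding residual_fun_upd N_def[symmetric] C_def G_def
        by (simp add: sum.distrib sum_subtractf sum_distrib_left sum_distrib_right algebra_simps)
      finally show ?thesis by simp
    qed
    from linear_coeff_eq_0_if_quadratic_nonneg[OF this C0]
    have G: "2 * G = s k * C" by (simp add: mult_ac)
    \<comment> \<open>Together with stationarity, \<open>2 * G \<le> C\<close> becomes
      \<open>s k * C \<le> C\<close>, which avoids dividing by a possibly zero
      \<open>C\<close>.\<close>
    have "0 \<le> (\<Sum>i\<in>UNIV. w i * (x i k - y i k)\<^sup>2)"
      by (intro sum_nonneg mult_nonneg_nonneg w0) auto
    also have "\<dots> = C - 2 * G"
      unfolding C_def G_def
      by (simp add: sum.distrib sum_subtractf sum_distrib_left power2_eq_square algebra_simps)
    finally have le: "s k * C \<le> C" using G by simp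
    have "?L = (2 * s k - 1) * (2 * G) - (s k)\<^sup>2 * C"
      unfolding C_def G_def
      by (simp add: sum.distrib sum_subtractf sum_distrib_left power2_eq_square algebra_simps)
    also have "\<dots> = s k * (s k * C - C)"
      unfolding G by (simp add: power2_eq_square algebra_simps)
    also have "\<dots> \<le> 0" using le s by (intro mult_nonneg_nonpos) auto
    finally show ?thesis .
  qed
  have "(\<Sum>i\<in>UNIV. sqrt (D i)) \<le> (\<Sum>i\<in>UNIV. sqrt (N i) + w i * (D i - N i))"
  proof (intro sum_mono tangent)
    show "0 \<le> D i" for i unfolding D_def by (intro sum_nonneg) auto
    fix i assume "N i = 0"
    then show "D i = 0"
      using residual_eq_0D(1)[of s "x i" "y i"] s by (simp add: N_def D_def)
  qed
  also have "\<dots> = (\<Sum>i\<in>UNIV. sqrt (N i)) + (\<Sum>i\<in>UNIV. \<Sum>k\<in>UNIV. w i * ((x i k - y i k)\<^sup>2 -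
      ((s k * x i k - y i k)\<^sup>2 + (s k * y i k - x i k)\<^sup>2)))"
  proof -
    have "D i - N i = (\<Sum>k\<in>UNIV. (x i k - y i k)\<^sup>2 -
        ((s k * x i k - y i k)\<^sup>2 + (s k * y i k - x i k)\<^sup>2))" for i
      unfolding D_def N_def residual_def by (simp only: sum_subtractf)
    then show ?thesis by (simp only: sum.distrib sum_distrib_left)
  qed
  also have "\<dots> \<le> (\<Sum>i\<in>UNIV. sqrt (N i))"
    by (subst sum.swap) (simp add: sum_nonpos contrib)
  finally show ?thesis unfolding N_def D_def .
qed

section \<open>Power means\<close>

lemma powr_mean_le:
  fixes u v r :: real
  assumes "0 \<le> u" "0 \<le> v" "1 \<le> r"
  shows "((u + v) / 2) powr r \<le> (u powr r + v powr r) / 2"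
proof (cases "0 < u \<and> 0 < v")
  case True
  then show ?thesis
    using convex_onD[OF powr_convex[OF assms(3)], of "1/2" u v] by (simp add: add_divide_distrib)
next
  case False
  \<comment> \<open>One argument is zero, so only \<open>(c / 2) powr r \<le> c powr r / 2\<close>
    remains.\<close>
  have "2 powr 1 \<le> (2::real) powr r" using assms by (intro powr_mono) auto
  then have "(c / 2) powr r \<le> c powr r / 2" if "0 \<le> c" for c :: real
    using that frac_le[of "c powr r" "c powr r" 2 "2 powr r"] by (simp add: powr_divide)
  with False assms show ?thesis by (cases "u = 0") auto
qed

text \<open>Convexity of the power \<open>r / 2 \<ge> 1\<close>, applied to the squares of
  \<open>a\<close> and \<open>b\<close>.\<close>

lemma sqrt_mean_squares_le_power_mean:
  fixes a b r :: real
  assumes "0 \<le> a" "0 \<le> b" "2 \<le> r"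
  shows "sqrt ((a\<^sup>2 + b\<^sup>2) / 2) \<le> ((a powr r + b powr r) / 2) powr (1 / r)"
proof -
  have "((a\<^sup>2 + b\<^sup>2) / 2) powr (r / 2) \<le> ((a\<^sup>2) powr (r / 2) + (b\<^sup>2) powr (r / 2)) / 2"
    using assms by (intro powr_mean_le) auto
  moreover have "(c\<^sup>2) powr (r / 2) = c powr r" if "0 \<le> c" for c :: real
    using that by (simp add: powr_powr flip: powr_numeral)
  ultimately have "((a\<^sup>2 + b\<^sup>2) / 2) powr (r / 2) \<le> (a powr r + b powr r) / 2"
    using assms by simp
  then have "(((a\<^sup>2 + b\<^sup>2) / 2) powr (r / 2)) powr (1 / r) \<le> ((a powr r + b powr r) / 2) powr (1 / r)"
    using assms by (intro powr_mono2) auto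
  moreover have "(((a\<^sup>2 + b\<^sup>2) / 2) powr (r / 2)) powr (1 / r) = sqrt ((a\<^sup>2 + b\<^sup>2) / 2)"
    using assms by (simp add: powr_powr powr_half_sqrt)
  ultimately show ?thesis by simp
qed

lemma sqrt_mean_squares_le_max:
  fixes a b :: real
  assumes "0 \<le> a" "0 \<le> b"
  shows "sqrt ((a\<^sup>2 + b\<^sup>2) / 2) \<le> max a b"
proof (rule real_le_lsqrt)
  have "a\<^sup>2 \<le> (max a b)\<^sup>2" "b\<^sup>2 \<le> (max a b)\<^sup>2"
    using assms by (auto intro!: power_mono)
  then show "(a\<^sup>2 + b\<^sup>2) / 2 \<le> (max a b)\<^sup>2" by simp
qed (use assms in auto)

section \<open>Comparing the energies\<close>

lemma E_p_2:
  "E_p 2 P Q A = (\<Sum>i\<in>UNIV. sqrt (((norm (A *v column i P - column i Q))\<^sup>2 +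
    (norm (transpose A *v column i Q - column i P))\<^sup>2) / 2))"
  by (simp add: E_p_def powr_half_sqrt)

text \<open>Reduces the factor 2 bound to exponent 2.\<close>

lemma E_p_2_le:
  assumes "2 \<le> p"
  shows "E_p 2 P Q A \<le> E_p p P Q A"
proof (cases "p = \<infinity>")
  case True
  then show ?thesis
    unfolding E_p_2 by (simp add: E_p_def sum_mono sqrt_mean_squares_le_max)
next
  case False
  then have "2 \<le> real_of_ereal p" using assms by (cases p) auto
  then show ?thesis
    using False unfolding E_p_2
    by (simp add: E_p_def sum_mono sqrt_mean_squares_le_power_mean)
qed

text \<open>Both residuals coincide on O(d), so their power mean is their common value. Minimizing
  \<open>E_p\<close> over all matrices thus relaxes the orthogonal problem.\<close>

lemma E_p_orthogonal:
  assumes "orthogonal_matrix R" "1 \<le> p"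
  shows "E_p p P Q R = E P Q R"
proof (cases "p = \<infinity>")
  case False
  then have "1 \<le> real_of_ereal p" using assms by (cases p) auto
  then show ?thesis
    using False by (simp add: E_p_def E_def norm_diff_transpose_orthogonal[OF assms(1)] powr_powr)
qed (simp add: E_p_def E_def norm_diff_transpose_orthogonal[OF assms(1)])

lemma E_orth_proj_le:
  assumes "is_orth_proj A R"
  shows "E P Q R \<le> 2 * E_p 2 P Q A"
  unfolding E_def E_p_2 sum_distrib_left
proof (rule sum_mono)
  fix i
  have "norm (R *v column i P - column i Q) \<le> sqrt (4 * (((norm (A *v column i P - column i Q))\<^sup>2 +
    (norm (transpose A *v column i Q - column i P))\<^sup>2) / 2))"
    using orth_proj_residual_le[OF assms, of "column i P" "column i Q"] by (intro real_le_rsqrt) simp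
  then show "norm (R *v column i P - column i Q) \<le> 2 * sqrt (((norm (A *v column i P - column i Q))\<^sup>2 +
    (norm (transpose A *v column i Q - column i P))\<^sup>2) / 2)"
    by (simp only: real_sqrt_mult real_sqrt_four)
qed

lemma E_orth_proj_le_sqrt2:
  fixes P Q :: "real ^ 'n ^ 'd"
  assumes min: "\<And>B. E_p 2 P Q A \<le> E_p 2 P Q B" and "is_orth_proj A R"
  shows "E P Q R \<le> sqrt 2 * E_p 2 P Q A"
  using assms(2)
proof (rule is_orth_projE)
  fix U V s
  assume U: "orthogonal_matrix U" and V: "orthogonal_matrix V"
    and A: "A = U ** diag_mat s ** transpose V"
    and s: "\<And>k. 0 \<le> s k"
    and R: "\<And>p q. (norm (R *v p - q))\<^sup>2 =
      (\<Sum>k\<in>UNIV. ((transpose V *v p) $ k - (transpose U *v q) $ k)\<^sup>2)"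
  define x where "x i k = (transpose V *v column i P) $ k" for i k
  define y where "y i k = (transpose U *v column i Q) $ k" for i k
  \<comment> \<open>Competitors share \<open>U\<close> and \<open>V\<close> with \<open>A\<close>
    and vary only the diagonal; \<open>sqrt 2\<close> cancels the halving in the mean.\<close>
  have E2: "sqrt 2 * E_p 2 P Q (U ** diag_mat s' ** transpose V) =
      (\<Sum>i\<in>UNIV. sqrt (residual s' (x i) (y i)))" for s'
    unfolding E_p_2 residual_diag_mat[OF U V refl] x_def y_def sum_distrib_left
    by (simp flip: real_sqrt_mult)
  have "E P Q R = (\<Sum>i\<in>UNIV. sqrt (\<Sum>k\<in>UNIV. (x i k - y i k)\<^sup>2))"
    unfolding E_def x_def y_def R[symmetric] by simp
  also have "\<dots> \<le> (\<Sum>i\<in>UNIV. sqrt (residual s (x i) (y i)))"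
    using min unfolding A
    by (intro sum_sqrt_residual_minimizer s) (simp flip: E2)
  finally show ?thesis unfolding A E2 .
qed

theorem theorem3p1:
  fixes P Q :: "real ^ 'n ^ 'd" and p :: ereal and A_star R_hat :: "real ^ 'd ^ 'd"
  assumes "2 \<le> p"
    and "is_arg_min (E_p p P Q) (\<lambda>A. True) A_star"
    and "is_orth_proj A_star R_hat"
  shows "(E_min P Q \<le> E P Q R_hat \<and>
          E P Q R_hat \<le> 2 * E_p p P Q A_star \<and>
          2 * E_p p P Q A_star \<le> 2 * E_min P Q) \<and>
         (p = 2 \<longrightarrow>
          E_min P Q \<le> E P Q R_hat \<and>
          E P Q R_hat \<le> sqrt 2 * E_p 2 P Q A_star \<and>
          sqrt 2 * E_p 2 P Q A_star \<le> sqrt 2 * E_min P Q)"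
proof -
  have min: "E_p p P Q A_star \<le> E_p p P Q B" for B
    using assms(2) by (simp add: is_arg_min_linorder)
  obtain R where R: "orthogonal_matrix R" "E P Q R = E_min P Q"
      "\<And>R'. orthogonal_matrix R' \<Longrightarrow> E P Q R \<le> E P Q R'"
    using E_min_attained by blast
  have "orthogonal_matrix R_hat"
    using assms(3) by (rule is_orth_projE)
  then have "E_min P Q \<le> E P Q R_hat" using R by metis
  moreover have "E P Q R_hat \<le> 2 * E_p p P Q A_star"
    using E_orth_proj_le[OF assms(3), of P Q] E_p_2_le[OF assms(1), of P Q A_star] by simp
  moreover have "1 \<le> p" using assms(1) by (rule order_trans[rotated]) simp
  \<comment> \<open>The optimal orthogonal \<open>R\<close> competes with
    \<open>A_star\<close>.\<close>
  then have "E_p p P Q A_star \<le> E_min P Q"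
    using min[of R] R E_p_orthogonal[of R p P Q] by simp
  moreover have "E P Q R_hat \<le> sqrt 2 * E_p 2 P Q A_star" if "p = 2"
    using E_orth_proj_le_sqrt2[OF _ assms(3)] min that by blast
  ultimately show ?thesis by auto
qed

end
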